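(* Let $n\geqslant 6$ be an integer and $p,q$ primes with $pq\mid n$ and $\gcd(pq,n/(pq))=1$. Let $S$ be a square-free and periodic subset of $\mathbb{Z}_n$ with $|S|=pq$. Then the connected Cayley sum graph $\mathrm{CS}(\mathbb{Z}_n,S)$ admits a total perfect code if and only if $s\not\equiv s'\pmod{pq}$ for all distinct $s,s'\in S$.
   Context: For an abelian group $G$ and $S\subseteq G$, the Cayley sum graph $\mathrm{CS}(G,S)$ has vertex set $G$, two vertices $g,h$ adjacent iff $g+h\in S$ and $g\neq h$. A total perfect code of a graph is a set $C$ of vertices such that every vertex has exactly one neighbor in $C$. $S$ is square-free if it contains no element of the form $y+y$, $y\in G$. A nonempty $X\subseteq G$ is periodic if its stabilizer $G_X=\{g\in G: X+g=X\}$ is not $\{0\}$, and aperiodic otherwise. The hypothesis "connected" means the theorem concerns those $S$ for which $\mathrm{CS}(\mathbb{Z}_n,S)$ is connected. Elements of $\mathbb{Z}_n$ are identified with integers $0,\dots,n-1$. *)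

theory Defs
  imports
    "HOL-Algebra.Elementary_Groups"
    "HOL-Algebra.Group_Action"
    "HOL-Number_Theory.Cong"
    "HOL-Computational_Algebra.Primes"
    "Graph_Theory.Digraph_Component"
begin

text \<open>
  Abelian groups are HOL-Algebra groups, so the sum of two elements is written multiplicatively
  in the general definitions; the cyclic group of order \<open>n\<close> is \<open>integer_mod_group n\<close>, with carrier
  \<open>{0..<int n}\<close> (for \<open>n > 0\<close>) and addition modulo \<open>n\<close>. Undirected graphs are symmetric digraphs.
\<close>

definition cayley_sum_graph :: "('a, 'b) monoid_scheme \<Rightarrow> 'a set \<Rightarrow> 'a pair_pre_digraph" where
  "cayley_sum_graph G S =
    \<lparr>pverts = carrier G,
     parcs = {(g, h). g \<in> carrier G \<and> h \<in> carrier G \<and> g \<otimes>\<^bsub>G\<^esub> h \<in> S \<and> g \<noteq> h}\<rparr>"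

lemma graph_cayley_sum_graph:
  assumes "comm_group G" "finite (carrier G)"
  shows "graph (with_proj (cayley_sum_graph G S))"
proof -
  interpret comm_group G by fact
  have "finite {(g, h). g \<in> carrier G \<and> h \<in> carrier G \<and> g \<otimes>\<^bsub>G\<^esub> h \<in> S \<and> g \<noteq> h}"
    by (rule finite_subset[of _ "carrier G \<times> carrier G"]) (auto simp: assms(2))
  then show ?thesis
    using assms(2)
    by unfold_locales
      (auto simp: cayley_sum_graph_def with_proj_def arc_to_ends_def symmetric_conv m_comm)
qed

definition total_perfect_code :: "('a, 'b) pre_digraph \<Rightarrow> 'a set \<Rightarrow> bool" where
  "total_perfect_code \<Gamma> C \<longleftrightarrow>
    C \<subseteq> verts \<Gamma> \<and> (\<forall>v \<in> verts \<Gamma>. \<exists>!c. c \<in> C \<and> v \<rightarrow>\<^bsub>\<Gamma>\<^esub> c)"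

definition square_free :: "('a, 'b) monoid_scheme \<Rightarrow> 'a set \<Rightarrow> bool" where
  "square_free G S \<longleftrightarrow> (\<forall>y \<in> carrier G. y \<otimes>\<^bsub>G\<^esub> y \<notin> S)"

text \<open>The stabilizer below is \<open>{g \<in> carrier G. X #>\<^bsub>G\<^esub> g = X}\<close>.\<close>

definition periodic :: "('a, 'b) monoid_scheme \<Rightarrow> 'a set \<Rightarrow> bool" where
  "periodic G X \<longleftrightarrow> X \<noteq> {} \<and> stabilizer G (\<lambda>g Y. Y #>\<^bsub>G\<^esub> g) X \<noteq> {\<one>\<^bsub>G\<^esub>}"

end

theory Submission
  imports Defs "HOL-Computational_Algebra.Polynomial"
begin

text \<open>
  Since \<open>S\<close> is square-free, the condition \<open>g \<noteq> h\<close> in the adjacency relation is automatic, so a total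
  perfect code \<open>C\<close> is the same as a tiling \<open>\<int>\<^sub>n = S \<oplus> (-C)\<close>. By Tijdeman's replacement principle, \<open>S\<close>
  may be multiplied by any \<open>k\<close> coprime to \<open>|S|\<close> without destroying the tiling; for \<open>k = n/(pq)\<close> the
  map \<open>s \<mapsto> ks\<close> identifies elements that are congruent modulo \<open>pq\<close>, so there are no two such elements
  in \<open>S\<close>. Conversely, if \<open>S\<close> is a system of residues modulo \<open>pq\<close>, the multiples of \<open>pq\<close> are a code.
  The replacement principle for a prime \<open>k\<close> follows from \<open>A(X)\<^sup>k \<equiv> A(X\<^sup>k)\<close> modulo \<open>k\<close> for
  \<open>A(X) = \<Sum>\<^sub>s X\<^sup>s\<close>: the number of representations of each \<open>g\<close> in \<open>kS \<oplus> (-C)\<close> is congruent to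
  \<open>|S|\<^sup>k\<^sup>-\<^sup>1 \<equiv> 1\<close>, hence positive, and it is 1 on average.
\<close>

section \<open>Frobenius congruence in commutative rings\<close>

lemma prime_dvd_binomial_error:
  fixes x y :: "'a::comm_ring_1"
  assumes "prime (k::nat)"
  shows "of_nat k dvd (x + y) ^ k - x ^ k - y ^ k"
proof -
  have "k > 0" using assms prime_gt_0_nat by blast
  then have split: "{..k} = insert 0 (insert k {0<..<k})" by auto
  have "(x + y) ^ k - x ^ k - y ^ k = (\<Sum>i\<in>{0<..<k}. of_nat (k choose i) * x ^ i * y ^ (k - i))"
    unfolding binomial_ring split using \<open>k > 0\<close> by simp
  also have "of_nat k dvd \<dots>"
  proof (rule dvd_sum)
    fix i assume "i \<in> {0<..<k}"
    then have "k dvd (k choose i)" using assms by (intro dvd_choose_prime) auto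
    then show "of_nat k dvd of_nat (k choose i) * x ^ i * y ^ (k - i)"
      by (metis dvd_mult2 dvd_def of_nat_mult)
  qed
  finally show ?thesis .
qed

text \<open>Additivity of the Frobenius map modulo \<open>k\<close>, as a divisibility so that the
  error is a multiple of an actual ring element. It serves both in \<open>int poly\<close> and, with
  all \<open>u i = 1\<close>, in \<open>int\<close>.\<close>

lemma prime_dvd_sum_power_error:
  fixes u :: "'i \<Rightarrow> 'a::comm_ring_1"
  assumes "prime (k::nat)" "finite I"
  shows "of_nat k dvd (\<Sum>i\<in>I. u i) ^ k - (\<Sum>i\<in>I. u i ^ k)"
  using assms(2)
proof induction
  case empty
  have "k > 0" using assms prime_gt_0_nat by blast
  then show ?case by (simp add: zero_power)
next
  case (insert j J)
  have "of_nat k dvd ((u j + sum u J) ^ k - u j ^ k - sum u J ^ k)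
      + (sum u J ^ k - (\<Sum>i\<in>J. u i ^ k))"
    using prime_dvd_binomial_error[OF assms(1)] insert.IH by (rule dvd_add)
  then show ?case using insert.hyps by (simp add: algebra_simps)
qed

section \<open>Polynomials acting on sequences, with the indeterminate as the shift\<close>

definition shift_action :: "'a::comm_ring_1 poly \<Rightarrow> (nat \<Rightarrow> 'a) \<Rightarrow> nat \<Rightarrow> 'a" where
  "shift_action P f x = (\<Sum>i\<le>degree P. coeff P i * f (x + i))"

text \<open>Padding with zero coefficients is harmless. It is needed for \<open>pCons c P\<close>,
  whose degree stays \<open>0\<close> instead of \<open>Suc (degree P)\<close> when
  \<open>P = 0\<close>.\<close>

lemma shift_action_bound:
  assumes "degree P \<le> N"
  shows "shift_action P f x = (\<Sum>i\<le>N. coeff P i * f (x + i))"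
  unfolding shift_action_def
  by (rule sum.mono_neutral_left) (use assms in \<open>auto simp: coeff_eq_0\<close>)

lemma shift_action_0 [simp]: "shift_action 0 f x = 0"
  by (simp add: shift_action_def)

lemma shift_action_pCons:
  "shift_action (pCons c P) f x = c * f x + shift_action P f (Suc x)"
  by (subst shift_action_bound[of _ "Suc (degree P)"])
    (simp_all add: degree_pCons_le sum.atMost_Suc_shift shift_action_def del: sum.atMost_Suc)

lemma shift_action_add: "shift_action (P + Q) f x = shift_action P f x + shift_action Q f x"
  by (induction P Q arbitrary: x rule: poly_induct2)
    (simp_all add: shift_action_pCons algebra_simps)

lemma shift_action_smult: "shift_action (smult c P) f x = c * shift_action P f x"
  by (induction P arbitrary: x) (simp_all add: shift_action_pCons algebra_simps)

text \<open>Products act by composition, so an identity for \<open>A ^ k\<close> becomes one between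
  sums of translates of \<open>f\<close>.\<close>

lemma shift_action_mult: "shift_action (P * Q) f x = shift_action P (shift_action Q f) x"
  by (induction P arbitrary: x)
    (simp_all add: shift_action_pCons shift_action_add shift_action_smult)

lemma shift_action_monom: "shift_action (monom c i) f x = c * f (x + i)"
  by (induction i arbitrary: x) (simp_all add: monom_0 monom_Suc shift_action_pCons)

lemma shift_action_sum: "shift_action (\<Sum>i\<in>I. P i) f x = (\<Sum>i\<in>I. shift_action (P i) f x)"
  by (induction I rule: infinite_finite_induct) (simp_all add: shift_action_add)

section \<open>Sums over a period and the replacement principle\<close>

lemma sum_shift_periodic:
  fixes f :: "nat \<Rightarrow> 'a::comm_monoid_add"
  assumes "\<And>x. f (x + n) = f x"
  shows "(\<Sum>x<n. f (x + c)) = (\<Sum>x<n. f x)"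
proof (induction c)
  case (Suc c)
  show ?case
  proof (cases n)
    case (Suc m)
    \<comment> \<open>Moving the window by one drops \<open>f c\<close> and gains
      \<open>f (c + n)\<close>, which are equal.\<close>
    have "(\<Sum>x<n. f (x + Suc c)) = (\<Sum>x<m. f (Suc x + c)) + f (c + n)"
      by (simp add: Suc add.commute)
    also have "\<dots> = (\<Sum>x<n. f (x + c))"
      by (simp only: assms Suc sum.lessThan_Suc_shift)
        (simp add: ac_simps assms[unfolded Suc, simplified])
    finally show ?thesis using Suc.IH by simp
  qed simp
qed simp

lemma tiling_prime_multiple:
  fixes f :: "nat \<Rightarrow> int" and a :: "'i \<Rightarrow> nat"
  assumes I: "finite I" and n: "n > 0"
    and nonneg: "\<And>x. f x \<ge> 0" and per: "\<And>x. f (x + n) = f x"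
    and tile: "\<And>x. (\<Sum>i\<in>I. f (x + a i)) = 1"
    and k: "prime k" "coprime k (card I)"
  shows "(\<Sum>i\<in>I. f (x + k * a i)) = 1"
proof -
  define A :: "int poly" where "A = (\<Sum>i\<in>I. monom 1 (a i))"
  define F where "F = (\<lambda>x. \<Sum>i\<in>I. f (x + k * a i))"
  have A: "shift_action A g x = (\<Sum>i\<in>I. g (x + a i))" for g x
    by (simp add: A_def shift_action_sum shift_action_monom)
  \<comment> \<open>The first factor \<open>A\<close> turns \<open>f\<close> into the constant 1;
    each further factor multiplies by \<open>card I\<close>.\<close>
  have pow: "shift_action (A ^ Suc j) f x = int (card I) ^ j" for j x
  proof (induction j arbitrary: x)
    case 0
    then show ?case by (simp add: A tile)
  next
    case (Suc j)
    have "shift_action (A ^ Suc (Suc j)) f x = shift_action A (shift_action (A ^ Suc j) f) x"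
      by (simp only: power_Suc[of A "Suc j"] shift_action_mult)
    then show ?case by (simp add: A Suc.IH del: power_Suc) simp
  qed
  have "of_nat k dvd A ^ k - (\<Sum>i\<in>I. monom 1 (a i) ^ k)"
    unfolding A_def by (rule prime_dvd_sum_power_error[OF k(1) I])
  then obtain R where R: "A ^ k = (\<Sum>i\<in>I. monom 1 (k * a i)) + of_nat k * R"
    by (auto simp: dvd_def monom_power algebra_simps)
  have k0: "k > 0" using k(1) prime_gt_0_nat by blast
  have kR: "of_nat k * R = smult (int k) R" by (simp add: of_nat_poly)
  have "int (card I) ^ (k - 1) = F x + int k * shift_action R f x" for x
    using arg_cong[OF R, of "\<lambda>P. shift_action P f x"] pow[of "k - 1" x] k0
    by (simp add: kR shift_action_add shift_action_smult shift_action_sum shift_action_monom F_def)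
  \<comment> \<open>Fermat's little theorem: the Frobenius congruence for a sum of ones, with the
    factor \<open>card I\<close> cancelled by coprimality.\<close>
  moreover have "[int (card I) ^ (k - 1) = 1] (mod int k)"
  proof -
    have "int k dvd int (card I) ^ k - int (card I)"
      using prime_dvd_sum_power_error[OF k(1) I, of "\<lambda>_. 1 :: int"] by simp
    also have "int (card I) ^ k - int (card I) = int (card I) * (int (card I) ^ (k - 1) - 1)"
      using k0 by (simp add: power_eq_if algebra_simps)
    finally show ?thesis
      using k(2) by (simp add: cong_iff_dvd_diff coprime_dvd_mult_right_iff)
  qed
  ultimately have "[F x = 1] (mod int k)" for x
    by (metis cong_add_lcancel_0 cong_mult_self_left cong_sym cong_trans)
  then have "F x \<noteq> 0" for x
    using k(1) by (metis cong_iff_dvd_diff diff_0 dvd_minus_iff int_dvd_int_iff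
        not_prime_1 nat_dvd_1_iff_1 of_nat_1)
  moreover have "F x \<ge> 0" for x by (simp add: F_def nonneg sum_nonneg)
  ultimately have pos: "F x > 0" for x by (simp add: order_less_le)
  \<comment> \<open>The total over a period does not depend on the offsets \<open>b\<close>, so
    \<open>F\<close> has the same total \<open>n\<close> as the given tiling.\<close>
  have total: "(\<Sum>x<n. \<Sum>i\<in>I. f (x + b i)) = int (card I) * (\<Sum>x<n. f x)" for b
    by (subst sum.swap) (simp add: sum_shift_periodic[of f, OF per])
  have sumF: "(\<Sum>x<n. F x - 1) = 0"
    using total[of "\<lambda>i. k * a i"] total[of a] by (simp add: F_def tile sum_subtractf)
  have Fper: "F (y + n) = F y" for y
    unfolding F_def using per[of "y + k * a i" for i] by (simp add: ac_simps)
  \<comment> \<open>Since \<open>x\<close> may lie beyond the first period, the period starting at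
    \<open>x\<close> is summed; its terms are nonnegative, so all vanish, and \<open>y = 0\<close>
    gives the claim.\<close>
  have "(\<Sum>y<n. F (y + x) - 1) = 0"
    using sum_shift_periodic[of "\<lambda>y. F y - 1" n x] sumF Fper by simp
  then have "\<forall>y\<in>{..<n}. F (y + x) - 1 = 0"
    by (subst (asm) sum_nonneg_eq_0_iff) (use pos in \<open>auto simp: int_one_le_iff_zero_less\<close>)
  from bspec[OF this, of 0] show ?thesis using n by (simp add: F_def)
qed

lemma tiling_coprime_multiple:
  fixes f :: "nat \<Rightarrow> int" and a :: "'i \<Rightarrow> nat"
  assumes "finite I" "n > 0" "\<And>x. f x \<ge> 0" "\<And>x. f (x + n) = f x"
    and "\<And>x. (\<Sum>i\<in>I. f (x + a i)) = 1"
    and "k > 0" "coprime k (card I)"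
  shows "(\<Sum>i\<in>I. f (x + k * a i)) = 1"
  using assms(6,7)
proof (induction k arbitrary: x rule: prime_divisors_induct)
  case zero
  then show ?case by simp
next
  case (unit k)
  then show ?case using assms(5) by simp
next
  case (factor k m)
  then have "m > 0" "coprime m (card I)" "coprime k (card I)" by auto
  \<comment> \<open>The prime case is applied to the offsets \<open>m * a i\<close>, which tile by
    the induction hypothesis.\<close>
  then have "(\<Sum>i\<in>I. f (x + k * (m * a i))) = 1"
    using assms(1-4) factor by (intro tiling_prime_multiple[where n = n, OF _ _ _ _ factor.IH]) auto
  then show ?case by (simp add: mult.assoc)
qed

section \<open>Total perfect codes of Cayley sum graphs of cyclic groups\<close>

lemma arc_cayley_sum_graph:
  assumes "n > 0" "square_free (integer_mod_group n) S"
  shows "g \<rightarrow>\<^bsub>with_proj (cayley_sum_graph (integer_mod_group n) S)\<^esub> h \<longleftrightarrow>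
    g \<in> {0..<int n} \<and> h \<in> {0..<int n} \<and> (g + h) mod int n \<in> S"
  using assms
  by (auto simp: cayley_sum_graph_def square_free_def arcs_ends_conv
      carrier_integer_mod_group mult_integer_mod_group)

lemma total_perfect_code_cayley_sum_graph:
  assumes "n > 0" "square_free (integer_mod_group n) S"
  shows "total_perfect_code (with_proj (cayley_sum_graph (integer_mod_group n) S)) C \<longleftrightarrow>
    C \<subseteq> {0..<int n} \<and> (\<forall>v\<in>{0..<int n}. \<exists>!c. c \<in> C \<and> (v + c) mod int n \<in> S)"
proof -
  have "verts (with_proj (cayley_sum_graph (integer_mod_group n) S)) = {0..<int n}"
    using assms by (simp add: cayley_sum_graph_def carrier_integer_mod_group)
  then show ?thesis
    unfolding total_perfect_code_def arc_cayley_sum_graph[OF assms]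
    by (intro conj_cong ball_cong arg_cong[of _ _ Ex1] ext) auto
qed

text \<open>By counting, the injective reduction modulo \<open>d\<close> is onto
  \<open>{0..<int d}\<close>. Thus \<open>S\<close> is a transversal of the subgroup
  \<open>C\<close>, and every coset \<open>v + C\<close> meets \<open>S\<close> once.\<close>

lemma ex_code_of_residue_system:
  fixes S :: "int set"
  assumes "d > 0" "d dvd n" "n > 0" "S \<subseteq> {0..<int n}" "card S = d"
    and "inj_on (\<lambda>s. s mod int d) S"
  defines "C \<equiv> {c \<in> {0..<int n}. int d dvd c}"
  assumes v: "v \<in> {0..<int n}"
  shows "\<exists>!c. c \<in> C \<and> (v + c) mod int n \<in> S"
proof -
  have dn: "int d dvd int n" using assms by simp
  have "(\<lambda>s. s mod int d) ` S = {0..<int d}"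
    by (rule card_subset_eq) (use assms in \<open>auto simp: card_image\<close>)
  moreover have "v mod int d \<in> {0..<int d}" using assms(1) by simp
  ultimately obtain s where s: "s \<in> S" "s mod int d = v mod int d" by (metis imageE)
  have eq: "(v + (s - v) mod int n) mod int n = s"
    using s(1) assms(4) by (simp add: mod_simps subset_iff)
  have "int d dvd (s - v) mod int n"
    using s(2) dn by (simp add: dvd_mod_iff mod_eq_dvd_iff)
  then have ex: "(s - v) mod int n \<in> C" using assms(3) by (simp add: C_def)
  show ?thesis
  proof (rule ex1I[of _ "(s - v) mod int n"])
    show "(s - v) mod int n \<in> C \<and> (v + (s - v) mod int n) mod int n \<in> S"
      using ex eq s by simp
  next
    fix c assume c: "c \<in> C \<and> (v + c) mod int n \<in> S"
    have "(v + c) mod int n mod int d = v mod int d"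
      using c dn by (simp add: C_def mod_mod_cancel mod_eq_dvd_iff)
    then have "(v + c) mod int n mod int d = s mod int d" by (simp only: s(2))
    then have "(v + c) mod int n = s"
      by (rule inj_onD[OF assms(6) _ conjunct2[OF c] s(1)])
    then have "(s - v) mod int n = (v + c - v) mod int n"
      using mod_diff_left_eq[of "v + c" "int n" v] by (simp only:)
    then show "c = (s - v) mod int n" using c by (simp add: C_def)
  qed
qed

lemma code_imp_inj_mod:
  fixes S C :: "int set"
  assumes "n > 0" "d dvd n" "coprime d (n div d)" "S \<subseteq> {0..<int n}" "card S = d"
    and "C \<subseteq> {0..<int n}"
    and code: "\<And>v. v \<in> {0..<int n} \<Longrightarrow> \<exists>!c. c \<in> C \<and> (v + c) mod int n \<in> S"
  shows "inj_on (\<lambda>s. s mod int d) S"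
proof (rule inj_onI, rule ccontr)
  fix s t assume st: "s \<in> S" "t \<in> S" "s mod int d = t mod int d" "s \<noteq> t"
  define m where "m = n div d"
  define f :: "nat \<Rightarrow> int" where "f = (\<lambda>x. of_bool (int x mod int n \<in> C))"
  have fin: "finite S" using assms(4) by (rule finite_subset) simp
  have tile: "(\<Sum>r\<in>S. f (x + nat r)) = 1" for x
  proof -
    \<comment> \<open>Modulo \<open>n\<close>, \<open>v + c = r\<close> holds iff
      \<open>x + r = c\<close>, so the code condition at \<open>-x\<close> says that exactly one
      \<open>r\<close> in \<open>S\<close> contributes to the sum.\<close>
    define v where "v = (- int x) mod int n"
    have "v \<in> {0..<int n}" using assms(1) by (simp add: v_def)
    then obtain c where c: "c \<in> C" "(v + c) mod int n \<in> S"
      and uniq: "\<And>c'. c' \<in> C \<Longrightarrow> (v + c') mod int n \<in> S \<Longrightarrow> c' = c"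
      using code by blast
    have "f (x + nat r) = of_bool (r = (v + c) mod int n)" if r: "r \<in> S" for r
    proof -
      have r0: "0 \<le> r" "r < int n" using r assms(4) by auto
      define c' where "c' = (int x + r) mod int n"
      have vc': "(v + c') mod int n = r"
        using r0 by (simp add: v_def c'_def mod_simps)
      have "(int x + (v + c) mod int n) mod int n = c"
        using c(1) assms(6) by (auto simp: v_def mod_simps)
      then have "c' \<in> C \<longleftrightarrow> r = (v + c) mod int n"
        using uniq[of c'] vc' r c(1) unfolding c'_def by auto
      then show ?thesis using r0 by (simp add: f_def c'_def)
    qed
    then have "(\<Sum>r\<in>S. f (x + nat r)) = (\<Sum>r\<in>S. of_bool (r = (v + c) mod int n))"
      by (rule sum.cong[OF refl])
    also have "\<dots> = 1" using fin c(2) by (simp add: of_bool_def)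
    finally show ?thesis .
  qed
  have "m > 0" using assms(1,2) by (auto simp: m_def elim!: dvdE)
  \<comment> \<open>The multiplier \<open>m\<close> is admissible as it is coprime to
    \<open>d = card S\<close>.\<close>
  have tile': "(\<Sum>r\<in>S. f (x + m * nat r)) = 1" for x
    by (rule tiling_coprime_multiple[where n = n])
      (use fin assms tile \<open>m > 0\<close> in \<open>auto simp: f_def m_def coprime_commute\<close>)
  obtain c where c: "c \<in> C" using code[of 0] assms(1) by auto
  \<comment> \<open>Chosen so that \<open>x + m * s\<close> is \<open>c\<close> modulo
    \<open>n\<close>. As \<open>n = m * d\<close> divides \<open>m * (t - s)\<close>,
    \<open>x + m * t\<close> is \<open>c\<close> too, and a sum equal to 1 would have two terms
    equal to 1.\<close>
  define x where "x = nat ((c - int m * s) mod int n)"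
  have s0: "0 \<le> s" "0 \<le> t" using st assms(4) by auto
  have x: "int x = (c - int m * s) mod int n" using assms(1) by (simp add: x_def)
  have "int n = int m * int d" using assms(2) by (simp add: m_def flip: of_nat_mult)
  moreover have "int d dvd t - s" using st(3) by (metis mod_eq_dvd_iff)
  ultimately have "(int m * t) mod int n = (int m * s) mod int n"
    by (simp add: mod_eq_dvd_iff flip: right_diff_distrib)
  moreover have "int (x + m * nat s) mod int n = c"
    using c assms(6) s0 by (auto simp: x mod_simps)
  ultimately have "f (x + m * nat s) = 1" "f (x + m * nat t) = 1"
    using c s0 by (auto simp: f_def) (metis mod_add_right_eq)
  then have "2 = (\<Sum>r\<in>{s,t}. f (x + m * nat r))" using st by simp
  also have "\<dots> \<le> (\<Sum>r\<in>S. f (x + m * nat r))"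
    by (rule sum_mono2) (use fin st in \<open>auto simp: f_def\<close>)
  finally show False using tile' by simp
qed

theorem theorem3p8:
  fixes n p q :: nat and S :: "int set"
  assumes "n \<ge> 6"
    and "Factorial_Ring.prime p" and "Factorial_Ring.prime q"
    and "p * q dvd n" and "gcd (p * q) (n div (p * q)) = 1"
    and "S \<subseteq> carrier (integer_mod_group n)"
    and "square_free (integer_mod_group n) S"
    and "periodic (integer_mod_group n) S"
    and "card S = p * q"
    and "Digraph_Component.connected (with_proj (cayley_sum_graph (integer_mod_group n) S))"
  shows "(\<exists>C. total_perfect_code (with_proj (cayley_sum_graph (integer_mod_group n) S)) C) \<longleftrightarrow>
    (\<forall>s \<in> S. \<forall>s' \<in> S. s \<noteq> s' \<longrightarrow> \<not> [s = s'] (mod int (p * q)))"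
proof -
  have n: "n > 0" using assms(1) by simp
  have d: "p * q > 0" using assms(2,3) prime_gt_0_nat by simp
  have S: "S \<subseteq> {0..<int n}" using assms(6) n by (simp add: carrier_integer_mod_group)
  have "(\<exists>C. total_perfect_code (with_proj (cayley_sum_graph (integer_mod_group n) S)) C) \<longleftrightarrow>
      inj_on (\<lambda>s. s mod int (p * q)) S"
    unfolding total_perfect_code_cayley_sum_graph[OF n assms(7)]
  proof
    assume "\<exists>C \<subseteq> {0..<int n}. \<forall>v\<in>{0..<int n}. \<exists>!c. c \<in> C \<and> (v + c) mod int n \<in> S"
    then show "inj_on (\<lambda>s. s mod int (p * q)) S"
      using code_imp_inj_mod[OF n assms(4) _ S assms(9)] assms(5)
      by (auto simp only: coprime_iff_gcd_eq_1)
  next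
    assume "inj_on (\<lambda>s. s mod int (p * q)) S"
    then show "\<exists>C \<subseteq> {0..<int n}. \<forall>v\<in>{0..<int n}. \<exists>!c. c \<in> C \<and> (v + c) mod int n \<in> S"
      using ex_code_of_residue_system[OF d assms(4) n S assms(9)]
      by (intro exI[of _ "{c \<in> {0..<int n}. int (p * q) dvd c}"]) auto
  qed
  then show ?thesis unfolding inj_on_def cong_def by blast
qed

end
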